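(* Let $\overline{m}G$ be a negative mixed star block graph with $k$ blocks $B_1,\dots,B_k$ of orders $n_1,\dots,n_k$, and for each $j$ let $D_{n_j}$ denote the determinant of the adjacency matrix of $\overline{m}K_{n_j}$ with one vertex deleted. Then $$\det(\overline{m}G)=\sum_{i=1}^k\det(\overline{m}K_{n_i})\prod_{j=1,\,j\ne i}^kD_{n_j}.$$
   Context: The negative mixed complete graph $\overline{m}K_n$ ($n>3$) is obtained from the directed cycle $v_1\to v_2\to\dots\to v_n\to v_1$ with all arcs of weight $-1$ by adding, with weight $+1$, both arcs between every pair of vertices non-adjacent in the underlying cycle (by symmetry, deleting any vertex gives the same determinant). A negative mixed star block graph is a strongly connected digraph whose blocks are negative mixed complete graphs $B_i\cong\overline{m}K_{n_i}$ and which has (at most) one cut-vertex, common to all blocks. $\det$ of a weighted digraph is the determinant of its adjacency matrix ($(p,q)$ entry equals the weight of the arc from vertex $p$ to vertex $q$, $0$ if none). *)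

theory Defs
  imports
    "Graph_Theory.Graph_Theory"
    "Graph_Theory.Weighted_Graph"
    "Jordan_Normal_Form.Determinant"
begin

section \<open>Determinant of a weighted digraph\<close>

text \<open>
  A weighted digraph is a pair of a digraph \<open>G\<close> and a weight function on its arcs; subdigraphs
  inherit the weight function. The arc described by \<open>THE\<close> is unique since \<open>digraph\<close>
  excludes parallel arcs.
\<close>

definition adj_entry :: "('a, 'b) pre_digraph \<Rightarrow> 'b weight_fun \<Rightarrow> 'a \<Rightarrow> 'a \<Rightarrow> real" where
  "adj_entry G w p q =
    (if p \<rightarrow>\<^bsub>G\<^esub> q then w (THE e. e \<in> arcs G \<and> arc_to_ends G e = (p, q)) else 0)"

definition adj_matrix ::
    "('a, 'b) pre_digraph \<Rightarrow> 'b weight_fun \<Rightarrow> 'a list \<Rightarrow> real mat" where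
  "adj_matrix G w vs =
    mat (length vs) (length vs) (\<lambda>(i, j). adj_entry G w (vs ! i) (vs ! j))"

text \<open>
  The determinant does not depend on the enumeration of the vertices, see
  \<open>digraph_det_eq\<close> below.
\<close>

definition digraph_det :: "('a, 'b) pre_digraph \<Rightarrow> 'b weight_fun \<Rightarrow> real" where
  "digraph_det G w = det (adj_matrix G w (SOME vs. distinct vs \<and> set vs = verts G))"

lemma det_adj_matrix_enumeration:
  assumes "distinct vs" "distinct us" "set vs = set us"
  shows "det (adj_matrix G w vs) = det (adj_matrix G w us)"
proof -
  define n where "n = length us"
  have len: "length vs = n"
    using assms by (metis distinct_card n_def)
  have "mset vs = mset us"
    using assms set_eq_iff_mset_eq_distinct by blast
  then obtain p where p: "p permutes {..<length us}" "permute_list p us = vs"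
    by (rule mset_eq_permutation)
  have p': "p permutes {0..<n}"
    using p(1) by (simp add: n_def atLeast0LessThan)
  have nth: "vs ! i = us ! p i" if "i < n" for i
    using p that by (auto simp: n_def permute_list_nth)
  have p_lt: "p i < n" if "i < n" for i
    using permutes_in_image[OF p'] that by simp
  define A where "A = adj_matrix G w us"
  define R where "R = mat n n (\<lambda>(i, j). A $$ (p i, j))"
  define C where "C = mat n n (\<lambda>(i, j). transpose_mat R $$ (p i, j))"
  have A: "A \<in> carrier_mat n n" and R: "R \<in> carrier_mat n n" and C: "C \<in> carrier_mat n n"
    by (simp_all add: A_def R_def C_def adj_matrix_def n_def)
  have "adj_matrix G w vs = transpose_mat C"
    by (rule eq_matI)
      (auto simp: adj_matrix_def A_def R_def C_def len nth p_lt n_def[symmetric])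
  then have "det (adj_matrix G w vs) = det C"
    using det_transpose[OF C] by simp
  also have "\<dots> = signof p * det R"
    unfolding C_def using R p' by (subst det_permute_rows) (auto simp: det_transpose)
  also have "det R = signof p * det A"
    unfolding R_def by (rule det_permute_rows[OF A p'])
  also have "signof p * (signof p * det A) = det A"
    by (simp add: sign_def)
  finally show ?thesis
    by (simp add: A_def)
qed

lemma digraph_det_eq:
  assumes "distinct vs" "set vs = verts G"
  shows "digraph_det G w = det (adj_matrix G w vs)"
proof -
  let ?us = "SOME us. distinct us \<and> set us = verts G"
  have "distinct ?us \<and> set ?us = verts G"
    by (rule someI[of _ vs]) (use assms in simp)
  then show ?thesis
    unfolding digraph_det_def using assms det_adj_matrix_enumeration by metis
qed


section \<open>Cut-vertices and blocks\<close>

text \<open>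
  As usual, components, cut-vertices and blocks refer to connectedness of the underlying
  undirected graph.
\<close>

definition components :: "('a, 'b) pre_digraph \<Rightarrow> ('a, 'b) pre_digraph set" where
  "components G = {C. pre_digraph.max_subgraph G connected C}"

definition cut_vertex :: "('a, 'b) pre_digraph \<Rightarrow> 'a \<Rightarrow> bool" where
  "cut_vertex G v \<longleftrightarrow>
    v \<in> verts G \<and> card (components G) < card (components (pre_digraph.del_vert G v))"

definition blocks :: "('a, 'b) pre_digraph \<Rightarrow> ('a, 'b) pre_digraph set" where
  "blocks G = {B. pre_digraph.max_subgraph G (\<lambda>H. connected H \<and> (\<nexists>v. cut_vertex H v)) B}"


section \<open>Negative mixed complete graphs\<close>

definition cycle_next :: "nat \<Rightarrow> nat \<Rightarrow> nat" where
  "cycle_next n i = (if i = n then 1 else Suc i)"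

definition cycle_arcs :: "nat \<Rightarrow> (nat \<times> nat) set" where
  "cycle_arcs n = {(i, cycle_next n i) | i. i \<in> {1..n}}"

definition chord_arcs :: "nat \<Rightarrow> (nat \<times> nat) set" where
  "chord_arcs n = {(i, j). i \<in> {1..n} \<and> j \<in> {1..n} \<and> i \<noteq> j \<and>
     (i, j) \<notin> cycle_arcs n \<and> (j, i) \<notin> cycle_arcs n}"

text \<open>Only meaningful for \<open>n > 3\<close>.\<close>

definition neg_mixed_complete :: "nat \<Rightarrow> (nat, nat \<times> nat) pre_digraph" where
  "neg_mixed_complete n =
    with_proj \<lparr> pverts = {1..n}, parcs = cycle_arcs n \<union> chord_arcs n \<rparr>"

definition neg_mixed_weight :: "nat \<Rightarrow> (nat \<times> nat) weight_fun" where
  "neg_mixed_weight n e = (if e \<in> cycle_arcs n then -1 else 1)"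


section \<open>Negative mixed star block graphs\<close>

definition weighted_iso ::
    "('a, 'b) pre_digraph \<Rightarrow> 'b weight_fun \<Rightarrow> ('c, 'd) pre_digraph \<Rightarrow> 'd weight_fun \<Rightarrow> bool" where
  "weighted_iso G w H w' \<longleftrightarrow>
    (\<exists>f. pre_digraph.digraph_isomorphism G f \<and> H = app_iso f G \<and>
      (\<forall>e \<in> arcs G. w' (iso_arcs f e) = w e))"

definition neg_mixed_star_block_graph :: "('a, 'b) pre_digraph \<Rightarrow> 'b weight_fun \<Rightarrow> bool" where
  "neg_mixed_star_block_graph G w \<longleftrightarrow>
    digraph G \<and> strongly_connected G \<and>
    (\<forall>B \<in> blocks G. \<exists>n > 3. weighted_iso B w (neg_mixed_complete n) (neg_mixed_weight n)) \<and>
    (\<forall>u v. cut_vertex G u \<and> cut_vertex G v \<longrightarrow> u = v) \<and>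
    (\<forall>c. cut_vertex G c \<longrightarrow> (\<forall>B \<in> blocks G. c \<in> verts B))"

end

theory Submission
  imports Defs
begin

text \<open>
  The blocks cover all arcs, and two distinct blocks share no vertex but the common one \<open>c\<close>: if
  they shared two vertices, their union would remain connected after deleting any vertex,
  contradicting maximality. Hence the adjacency matrix is block diagonal apart from the row and
  column of \<open>c\<close>, whose diagonal entry vanishes. Splitting the row of \<open>c\<close> into its restrictions to
  the blocks, each summand becomes block triangular and contributes the determinant of one block
  times the determinants of the others with \<open>c\<close> deleted. Which vertex of
  \<open>neg_mixed_complete n\<close> is deleted does not matter, since the cycle can be rotated.
\<close>

section \<open>Determinants of arrays indexed by finite sets\<close>

definition fun_mat :: "('a \<Rightarrow> 'a \<Rightarrow> real) \<Rightarrow> 'a list \<Rightarrow> real mat" where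
  "fun_mat f vs = mat (length vs) (length vs) (\<lambda>(i, j). f (vs ! i) (vs ! j))"

text \<open>
  The array \<open>f\<close> is the adjacency matrix of the digraph with all pairs as arcs and weights \<open>f\<close>,
  so that independence of the enumeration carries over from \<open>digraph_det\<close>.
\<close>

definition det_on :: "('a \<Rightarrow> 'a \<Rightarrow> real) \<Rightarrow> 'a set \<Rightarrow> real" where
  "det_on f S =
    digraph_det \<lparr> verts = S, arcs = UNIV, tail = fst, head = snd \<rparr> (\<lambda>(p, q). f p q)"

lemma fun_mat_carrier [simp]: "fun_mat f vs \<in> carrier_mat (length vs) (length vs)"
  by (simp add: fun_mat_def)

lemma adj_matrix_eq_fun_mat: "adj_matrix G w vs = fun_mat (adj_entry G w) vs"
  by (simp add: adj_matrix_def fun_mat_def)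

lemma det_on_eq:
  assumes "distinct vs" "set vs = S"
  shows "det_on f S = det (fun_mat f vs)"
proof -
  let ?H = "\<lparr> verts = S, arcs = UNIV, tail = fst, head = snd \<rparr>"
  have "adj_entry ?H (\<lambda>(p, q). f p q) p q = f p q" for p q
  proof -
    have "(THE e. e \<in> arcs ?H \<and> arc_to_ends ?H e = (p, q)) = (p, q)"
      by (rule the_equality) (auto simp: arc_to_ends_def)
    moreover have "p \<rightarrow>\<^bsub>?H\<^esub> q"
      by (auto simp: arcs_ends_conv image_iff)
    ultimately show ?thesis
      by (simp add: adj_entry_def)
  qed
  then have "adj_entry ?H (\<lambda>(p, q). f p q) = f"
    by (intro ext) simp
  then show ?thesis
    unfolding det_on_def using assms
    by (subst digraph_det_eq[of vs]) (simp_all add: adj_matrix_eq_fun_mat)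
qed

lemma digraph_det_eq_det_on:
  assumes "finite (verts G)"
  shows "digraph_det G w = det_on (adj_entry G w) (verts G)"
proof -
  obtain vs where "distinct vs" "set vs = verts G"
    using finite_distinct_list[OF assms] by blast
  then show ?thesis
    by (simp add: digraph_det_eq det_on_eq adj_matrix_eq_fun_mat)
qed

section \<open>Congruence, relabelling and the smallest index sets\<close>

lemma fun_mat_cong:
  assumes "\<And>x y. x \<in> set vs \<Longrightarrow> y \<in> set vs \<Longrightarrow> f x y = g x y"
  shows "fun_mat f vs = fun_mat g vs"
  unfolding fun_mat_def by (rule eq_matI) (auto simp: assms)

lemma det_on_cong:
  assumes "finite S" "\<And>x y. x \<in> S \<Longrightarrow> y \<in> S \<Longrightarrow> f x y = g x y"
  shows "det_on f S = det_on g S"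
proof -
  obtain vs where "distinct vs" "set vs = S"
    using finite_distinct_list[OF assms(1)] by blast
  then show ?thesis
    using assms(2) fun_mat_cong[of vs f g] by (simp add: det_on_eq)
qed

text \<open>Mapping an enumeration of \<open>S\<close> along \<open>h\<close> leaves the matrix
  itself unchanged. This transports determinants along graph isomorphisms and along the rotation of
  the cycle.\<close>

lemma det_on_image:
  assumes "finite S" "inj_on h S"
  shows "det_on f (h ` S) = det_on (\<lambda>x y. f (h x) (h y)) S"
proof -
  obtain vs where vs: "distinct vs" "set vs = S"
    using finite_distinct_list[OF assms(1)] by blast
  have "fun_mat f (map h vs) = fun_mat (\<lambda>x y. f (h x) (h y)) vs"
    unfolding fun_mat_def by (rule eq_matI) auto
  moreover have "distinct (map h vs)" "set (map h vs) = h ` S"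
    using vs assms(2) by (auto simp: distinct_map)
  ultimately show ?thesis
    using vs by (simp only: det_on_eq)
qed

lemma det_on_empty: "det_on f {} = 1"
  by (subst det_on_eq[of "[]"]) (auto simp: fun_mat_def)

lemma det_on_singleton: "det_on f {c} = f c c"
  by (subst det_on_eq[of "[c]"]) (auto simp: fun_mat_def det_single)

text \<open>Listing \<open>S\<close> before \<open>T\<close> puts the vanishing entries in the upper
  right block. Entries from \<open>T\<close> to \<open>S\<close> are unrestricted, which lets a
  shared vertex keep its full column.\<close>

lemma det_on_block_triangular:
  assumes "finite S" "finite T" "S \<inter> T = {}"
    and zero: "\<And>x y. x \<in> S \<Longrightarrow> y \<in> T \<Longrightarrow> f x y = 0"
  shows "det_on f (S \<union> T) = det_on f S * det_on f T"
proof -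
  obtain xs where xs: "distinct xs" "set xs = S"
    using finite_distinct_list[OF assms(1)] by blast
  obtain ys where ys: "distinct ys" "set ys = T"
    using finite_distinct_list[OF assms(2)] by blast
  let ?n = "length xs" and ?m = "length ys"
  let ?L = "mat ?m ?n (\<lambda>(i, j). f (ys ! i) (xs ! j))"
  have zero': "f (xs ! i) (ys ! j) = 0" if "i < ?n" "j < ?m" for i j
    using zero that xs(2) ys(2) by (metis nth_mem)
  have "fun_mat f (xs @ ys)
      = four_block_mat (fun_mat f xs) (0\<^sub>m ?n ?m) ?L (fun_mat f ys)"
    by (rule eq_matI) (auto simp: fun_mat_def nth_append zero')
  then have "det (fun_mat f (xs @ ys)) = det (fun_mat f xs) * det (fun_mat f ys)"
    by (simp add: det_four_block_mat_upper_right_zero[of _ ?n _ ?m])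
  moreover have "distinct (xs @ ys)" "set (xs @ ys) = S \<union> T"
    using xs ys assms(3) by auto
  ultimately show ?thesis
    using xs ys by (simp only: det_on_eq)
qed

text \<open>Linearity of the determinant in the row of \<open>c\<close>: each Leibniz product has
  exactly one factor from that row, and its other factors agree for \<open>f\<close>,
  \<open>g\<close> and \<open>h\<close>.\<close>

lemma det_on_row_add:
  assumes "finite S" "c \<in> S"
    and row: "\<And>y. y \<in> S \<Longrightarrow> f c y = g c y + h c y"
    and other: "\<And>x y. x \<in> S \<Longrightarrow> y \<in> S \<Longrightarrow> x \<noteq> c \<Longrightarrow> g x y = f x y \<and> h x y = f x y"
  shows "det_on f S = det_on g S + det_on h S"
proof -
  obtain vs where vs: "distinct vs" "set vs = S"
    using finite_distinct_list[OF assms(1)] by blast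
  let ?n = "length vs"
  obtain k where k: "k < ?n" "vs ! k = c"
    using assms(2) vs by (metis in_set_conv_nth)
  have "signof p * (\<Prod>i = 0..<?n. fun_mat f vs $$ (i, p i))
      = signof p * (\<Prod>i = 0..<?n. fun_mat g vs $$ (i, p i))
        + signof p * (\<Prod>i = 0..<?n. fun_mat h vs $$ (i, p i))"
    if p: "p permutes {0..<?n}" for p
  proof -
    have p_lt: "p i < ?n" if "i < ?n" for i
      using permutes_in_image[OF p] that by simp
    let ?R = "\<lambda>f. \<Prod>i \<in> {0..<?n} - {k}. fun_mat f vs $$ (i, p i)"
    have split: "(\<Prod>i = 0..<?n. fun_mat f vs $$ (i, p i)) = f c (vs ! p k) * ?R f" for f
      using k p_lt[OF k(1)] by (subst prod.remove[of _ k]) (auto simp: fun_mat_def)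
    have eq: "g (vs ! i) (vs ! p i) = f (vs ! i) (vs ! p i)"
        "h (vs ! i) (vs ! p i) = f (vs ! i) (vs ! p i)" if "i < ?n" "i \<noteq> k" for i
    proof -
      have "vs ! i \<noteq> c"
        using that k vs(1) nth_eq_iff_index_eq by blast
      moreover have "vs ! i \<in> S" "vs ! p i \<in> S"
        using that p_lt vs(2) by auto
      ultimately show "g (vs ! i) (vs ! p i) = f (vs ! i) (vs ! p i)"
        "h (vs ! i) (vs ! p i) = f (vs ! i) (vs ! p i)"
        using other by auto
    qed
    have "?R g = ?R f" "?R h = ?R f"
      by (rule prod.cong; auto simp: fun_mat_def p_lt eq)+
    moreover have "f c (vs ! p k) = g c (vs ! p k) + h c (vs ! p k)"
      using row p_lt[OF k(1)] vs(2) by auto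
    ultimately show ?thesis
      by (simp add: split algebra_simps)
  qed
  then have "det (fun_mat f vs) = det (fun_mat g vs) + det (fun_mat h vs)"
    by (simp add: det_def'[OF fun_mat_carrier] sum.distrib[symmetric])
  then show ?thesis
    using vs by (simp add: det_on_eq)
qed

text \<open>In \<open>?g\<close> the row of \<open>c\<close> loses its entries in \<open>T\<close>,
  in \<open>?h\<close> those in \<open>S\<close>. Then \<open>c\<close> can be grouped with
  \<open>S\<close> in the first array and with \<open>T\<close> in the second, each being block
  triangular; the column of \<open>c\<close> stays intact.\<close>

lemma det_on_glue:
  assumes fin: "finite S" "finite T" and disj: "S \<inter> T = {}" "c \<notin> S" "c \<notin> T"
    and zero: "\<And>x y. x \<in> S \<Longrightarrow> y \<in> T \<Longrightarrow> f x y = 0 \<and> f y x = 0"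
    and diag: "f c c = 0"
  shows "det_on f (insert c (S \<union> T))
    = det_on f (insert c S) * det_on f T + det_on f S * det_on f (insert c T)"
proof -
  let ?g = "\<lambda>x y. if x = c \<and> y \<in> T then 0 else f x y"
  let ?h = "\<lambda>x y. if x = c \<and> y \<in> S then 0 else f x y"
  have "det_on ?g (insert c S \<union> T) = det_on ?g (insert c S) * det_on ?g T"
    using fin disj zero by (intro det_on_block_triangular) auto
  also have "det_on ?g (insert c S) = det_on f (insert c S)"
    using fin disj by (intro det_on_cong) auto
  also have "det_on ?g T = det_on f T"
    using fin disj by (intro det_on_cong) auto
  finally have g: "det_on ?g (insert c (S \<union> T)) = det_on f (insert c S) * det_on f T"
    by simp
  have "det_on ?h (insert c T \<union> S) = det_on ?h (insert c T) * det_on ?h S"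
    using fin disj zero by (intro det_on_block_triangular) auto
  also have "det_on ?h (insert c T) = det_on f (insert c T)"
    using fin disj by (intro det_on_cong) auto
  also have "det_on ?h S = det_on f S"
    using fin disj by (intro det_on_cong) auto
  finally have h: "det_on ?h (insert c (S \<union> T)) = det_on f S * det_on f (insert c T)"
    by (simp add: Un_commute mult.commute)
  \<comment> \<open>Both arrays retain the entry at \<open>(c, c)\<close>, so the rows add up to
    that of \<open>f\<close> only because \<open>f c c = 0\<close>.\<close>
  have "det_on f (insert c (S \<union> T))
      = det_on ?g (insert c (S \<union> T)) + det_on ?h (insert c (S \<union> T))"
    using fin disj diag by (intro det_on_row_add[of _ c]) auto
  then show ?thesis
    by (simp only: g h)
qed

lemma det_on_UNION:
  assumes "finite I" "\<And>i. i \<in> I \<Longrightarrow> finite (V i)"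
    and "\<And>i j. i \<in> I \<Longrightarrow> j \<in> I \<Longrightarrow> i \<noteq> j \<Longrightarrow> V i \<inter> V j = {}"
    and "\<And>i j x y. i \<in> I \<Longrightarrow> j \<in> I \<Longrightarrow> i \<noteq> j \<Longrightarrow> x \<in> V i \<Longrightarrow> y \<in> V j \<Longrightarrow> f x y = 0"
  shows "det_on f (\<Union>i\<in>I. V i) = (\<Prod>i\<in>I. det_on f (V i))"
  using assms
proof (induction I rule: finite_induct)
  case empty
  then show ?case by (simp add: det_on_empty)
next
  case (insert i I)
  have "det_on f (V i \<union> (\<Union>j\<in>I. V j)) = det_on f (V i) * det_on f (\<Union>j\<in>I. V j)"
  proof (rule det_on_block_triangular)
    show "V i \<inter> (\<Union>j\<in>I. V j) = {}"
      using insert.hyps insert.prems(2)[of i] by auto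
    show "f x y = 0" if "x \<in> V i" "y \<in> (\<Union>j\<in>I. V j)" for x y
      using that insert.hyps insert.prems(3)[of i _ x y] by auto
  qed (use insert in auto)
  moreover have "det_on f (\<Union>j\<in>I. V j) = (\<Prod>j\<in>I. det_on f (V j))"
    by (rule insert.IH) (simp_all add: insert.prems(1,2), metis insert.prems(3) insertCI)
  ultimately show ?case
    using insert.hyps by simp
qed

text \<open>Induction on the set of blocks: \<open>det_on_glue\<close> attaches one block to the
  union of the others at \<open>c\<close>. The resulting recursion is that of the product rule, the
  block that keeps \<open>c\<close> playing the part of the differentiated factor.\<close>

lemma det_on_star:
  assumes "finite I" "\<And>i. i \<in> I \<Longrightarrow> finite (V i)" "\<And>i. i \<in> I \<Longrightarrow> c \<notin> V i"
    and "\<And>i j. i \<in> I \<Longrightarrow> j \<in> I \<Longrightarrow> i \<noteq> j \<Longrightarrow> V i \<inter> V j = {}"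
    and "\<And>i j x y. i \<in> I \<Longrightarrow> j \<in> I \<Longrightarrow> i \<noteq> j \<Longrightarrow> x \<in> V i \<Longrightarrow> y \<in> V j \<Longrightarrow> f x y = 0"
    and "f c c = 0"
  shows "det_on f (insert c (\<Union>i\<in>I. V i))
    = (\<Sum>i\<in>I. det_on f (insert c (V i)) * (\<Prod>j\<in>I - {i}. det_on f (V j)))"
  using assms
proof (induction I rule: finite_induct)
  case empty
  \<comment> \<open>Without blocks only the entry \<open>f c c = 0\<close> remains, matching the
    empty sum.\<close>
  then show ?case by (simp add: det_on_singleton)
next
  case (insert i I)
  let ?d = "\<lambda>i. det_on f (V i)" and ?e = "\<lambda>i. det_on f (insert c (V i))"
  have "det_on f (insert c (V i \<union> (\<Union>j\<in>I. V j)))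
      = ?e i * det_on f (\<Union>j\<in>I. V j) + ?d i * det_on f (insert c (\<Union>j\<in>I. V j))"
  proof (rule det_on_glue)
    show "V i \<inter> (\<Union>j\<in>I. V j) = {}"
      using insert.hyps insert.prems(3)[of i] by auto
    show "f x y = 0 \<and> f y x = 0" if x: "x \<in> V i" and y: "y \<in> (\<Union>j\<in>I. V j)" for x y
    proof -
      obtain j where "j \<in> I" "y \<in> V j" "i \<noteq> j"
        using y insert.hyps by auto
      then show ?thesis
        using x insert.prems(4)[of i j x y] insert.prems(4)[of j i y x] by auto
    qed
  qed (use insert in auto)
  moreover have "det_on f (\<Union>j\<in>I. V j) = (\<Prod>j\<in>I. ?d j)"
    by (rule det_on_UNION)
      (simp_all add: insert.hyps insert.prems(1,3), metis insert.prems(4) insertCI)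
  moreover have "det_on f (insert c (\<Union>j\<in>I. V j)) = (\<Sum>j\<in>I. ?e j * (\<Prod>l\<in>I - {j}. ?d l))"
    by (rule insert.IH)
      (simp_all add: insert.prems(1,2,3,5), metis insert.prems(4) insertCI)
  \<comment> \<open>The factor \<open>?d i\<close> in front of the induction hypothesis completes
    each of its products.\<close>
  moreover have "(\<Prod>l\<in>insert i I - {j}. ?d l) = ?d i * (\<Prod>l\<in>I - {j}. ?d l)" if "j \<in> I" for j
  proof -
    have "insert i I - {j} = insert i (I - {j})"
      using that insert.hyps by auto
    then show ?thesis
      using insert.hyps by simp
  qed
  moreover have "insert i I - {i} = I"
    using insert.hyps by auto
  ultimately show ?case
    using insert.hyps by (simp add: sum_distrib_left algebra_simps)
qed


section \<open>Components and blocks\<close>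

lemma connected_iff:
  "connected H \<longleftrightarrow>
    verts H \<noteq> {} \<and> (\<forall>u \<in> verts H. \<forall>v \<in> verts H. u \<rightarrow>\<^sup>*\<^bsub>mk_symmetric H\<^esub> v)"
  by (simp add: connected_def strongly_connected_def)

text \<open>The common vertex \<open>x\<close> is a hub: in the symmetric closure of the union every
  vertex reaches it and is reached from it.\<close>

lemma (in wf_digraph) connected_union:
  assumes sub: "subgraph H G" "subgraph K G"
    and conn: "connected H" "connected K"
    and x: "x \<in> verts H" "x \<in> verts K"
  shows "connected (union H K)"
proof -
  have compat: "compatible H K" and wf: "wf_digraph H" "wf_digraph K"
    using sub unfolding subgraph_def compatible_def by auto
  let ?U = "mk_symmetric (union H K)"
  interpret U: wf_digraph "union H K"
    using wf compat by (rule wellformed_union)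
  interpret S: pair_wf_digraph ?U
    by (rule U.wellformed_mk_symmetric)
  have mono: "subgraph (mk_symmetric H) ?U" "subgraph (mk_symmetric K) ?U"
    using subgraphs_of_union[OF wf compat] by (auto intro: subgraph_mk_symmetric)
  have "u \<rightarrow>\<^sup>*\<^bsub>?U\<^esub> x \<and> x \<rightarrow>\<^sup>*\<^bsub>?U\<^esub> u" if "u \<in> verts (union H K)" for u
    using that conn x pre_digraph.reachable_mono[OF _ mono(1)]
      pre_digraph.reachable_mono[OF _ mono(2)]
    unfolding connected_iff by auto
  then show ?thesis
    unfolding connected_iff using x by (auto intro: S.reachable_trans)
qed

text \<open>A subgraph inherits the functions \<open>tail\<close> and \<open>head\<close> from
  \<open>G\<close>, so its vertex and arc sets determine it.\<close>

lemma (in fin_digraph) finite_subgraphs: "finite {H. subgraph H G}"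
proof (rule finite_imageD)
  let ?h = "\<lambda>H. (verts H, arcs H)"
  have "?h ` {H. subgraph H G} \<subseteq> Pow (verts G) \<times> Pow (arcs G)"
    by auto
  then show "finite (?h ` {H. subgraph H G})"
    by (rule finite_subset) simp
  show "inj_on ?h {H. subgraph H G}"
    by (rule inj_onI) (auto simp: subgraph_def compatible_def)
qed

text \<open>Among the subgraphs with \<open>P\<close> that contain \<open>H\<close>, one with the
  largest total number of vertices and arcs is maximal. Small connected seeds are thereby extended
  to components and blocks.\<close>

lemma (in fin_digraph) ex_max_subgraph:
  assumes "subgraph H G" "P H"
  obtains K where "max_subgraph P K" "subgraph H K"
proof -
  let ?Q = "\<lambda>K. subgraph K G \<and> P K \<and> subgraph H K"
  let ?m = "\<lambda>K. card (verts K) + card (arcs K)"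
  have "?Q H"
    using assms by (auto intro: wf_digraph.subgraph_refl)
  moreover have "?m K \<le> ?m G" if "?Q K" for K
    using that by (intro add_mono card_mono) auto
  ultimately have "\<exists>K. ?Q K \<and> (\<forall>L. ?Q L \<longrightarrow> ?m L \<le> ?m K)"
    by (intro ex_has_greatest_nat[of ?Q H ?m "Suc (?m G)"]) (auto simp: less_Suc_eq_le)
  then obtain K where K: "?Q K" and max: "\<And>L. ?Q L \<Longrightarrow> ?m L \<le> ?m K"
    by blast
  have "max_subgraph P K"
  proof (rule max_subgraphI)
    fix L assume L: "K \<noteq> L" "subgraph K L" "subgraph L G"
    show "\<not> P L"
    proof
      assume "P L"
      \<comment> \<open>\<open>L\<close> contains \<open>H\<close> by transitivity, so it competes
        with \<open>K\<close>; equal sizes then force \<open>K = L\<close>.\<close>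
      then have le: "?m L \<le> ?m K"
        using K L by (intro max) (auto intro: subgraph_trans)
      interpret L: fin_digraph L
        using L(3) by (rule fin_digraph_subgraph)
      have sub: "verts K \<subseteq> verts L" "arcs K \<subseteq> arcs L"
        using L(2) by auto
      then have "card (verts K) \<le> card (verts L)" "card (arcs K) \<le> card (arcs L)"
        by (auto intro: card_mono)
      with le have "card (verts K) = card (verts L)" "card (arcs K) = card (arcs L)"
        by auto
      with sub have "verts K = verts L" "arcs K = arcs L"
        by (simp_all add: card_subset_eq)
      then have "K = L"
        using L(2) by (auto simp: subgraph_def compatible_def)
      with L(1) show False ..
    qed
  qed (use K in auto)
  then show ?thesis
    using K that by blast
qed

lemma (in wf_digraph) max_subgraph_iff_eq:
  assumes "P G"
  shows "max_subgraph P H \<longleftrightarrow> H = G"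
proof
  show "max_subgraph P H \<Longrightarrow> H = G"
    using assms subgraph_refl by (auto simp: max_subgraph_def)
  show "H = G \<Longrightarrow> max_subgraph P H"
    using assms subgraph_refl by (auto simp: max_subgraph_def subgraph_def compatible_def)
qed

section \<open>Components and cut-vertices in terms of connectedness\<close>

lemma (in wf_digraph) components_connected:
  assumes "connected G"
  shows "components G = {G}"
  using assms by (simp add: components_def max_subgraph_iff_eq)

lemma components_empty:
  assumes "verts H = {}"
  shows "components H = {}"
  using assms by (auto simp: components_def pre_digraph.max_subgraph_def connected_iff)

text \<open>\<open>tail\<close> and \<open>head\<close> are kept although there are no arcs, since
  \<open>subgraph\<close> requires compatible digraphs.\<close>

definition singleton_subgraph :: "('a, 'b) pre_digraph \<Rightarrow> 'a \<Rightarrow> ('a, 'b) pre_digraph" where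
  "singleton_subgraph G x = \<lparr> verts = {x}, arcs = {}, tail = tail G, head = head G \<rparr>"

lemma (in wf_digraph) subgraph_singleton:
  assumes "x \<in> verts G"
  shows "subgraph (singleton_subgraph G x) G"
  using assms wf_digraph
  by (auto simp: subgraph_def compatible_def singleton_subgraph_def wf_digraph_def)

lemma connected_of_verts_singleton:
  assumes "verts H = {x}"
  shows "connected H"
  using assms by (auto simp: connected_iff reachable_def)

text \<open>Every vertex lies in some component, obtained by extending its singleton; with at most
  one component, any two vertices share theirs.\<close>

lemma (in fin_digraph) connected_if_card_components:
  assumes "verts G \<noteq> {}" "card (components G) \<le> 1"
  shows "connected G"
  unfolding connected_iff
proof (intro conjI ballI)
  show "verts G \<noteq> {}" by fact
  fix u v assume uv: "u \<in> verts G" "v \<in> verts G"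
  have comp: "\<exists>C \<in> components G. x \<in> verts C" if "x \<in> verts G" for x
  proof -
    obtain C where "max_subgraph connected C" "subgraph (singleton_subgraph G x) C"
    proof (rule ex_max_subgraph)
      show "subgraph (singleton_subgraph G x) G"
        by (rule subgraph_singleton) fact
      show "connected (singleton_subgraph G x)"
        by (rule connected_of_verts_singleton) (simp add: singleton_subgraph_def)
    qed
    then show ?thesis
      by (auto simp: components_def subgraph_def singleton_subgraph_def)
  qed
  obtain C where C: "C \<in> components G" "u \<in> verts C"
    using comp uv by blast
  obtain D where D: "D \<in> components G" "v \<in> verts D"
    using comp uv by blast
  \<comment> \<open>Needed because \<open>card\<close> of an infinite set is 0, which would also
    satisfy the bound.\<close>
  have "finite (components G)"
    by (rule finite_subset[OF _ finite_subgraphs])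
      (auto simp: components_def max_subgraph_def)
  then have "C = D"
    using C D assms(2) card_le_Suc0_iff_eq by auto
  moreover have "connected C" "subgraph C G"
    using C by (auto simp: components_def max_subgraph_def)
  ultimately have "u \<rightarrow>\<^sup>*\<^bsub>mk_symmetric C\<^esub> v" "subgraph (mk_symmetric C) (mk_symmetric G)"
    using C D by (auto simp: connected_iff intro: subgraph_mk_symmetric)
  then show "u \<rightarrow>\<^sup>*\<^bsub>mk_symmetric G\<^esub> v"
    by (rule pre_digraph.reachable_mono)
qed

text \<open>Translates the counting definition of a cut-vertex into connectedness. A lone vertex is
  excluded because the empty digraph is not \<open>connected\<close>.\<close>

lemma (in fin_digraph) connected_del_vert:
  assumes "connected G" "\<not> cut_vertex G v" "verts G \<noteq> {v}"
  shows "connected (del_vert v)"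
proof (cases "v \<in> verts G")
  case True
  interpret D: fin_digraph "del_vert v"
    by (rule fin_digraph_subgraph) (rule subgraph_del_vert)
  show ?thesis
  proof (rule D.connected_if_card_components)
    show "verts (del_vert v) \<noteq> {}"
      using True assms(3) by (auto simp: del_vert_simps)
    show "card (components (del_vert v)) \<le> 1"
      using assms True by (simp add: cut_vertex_def components_connected)
  qed
next
  case False
  then have "del_vert v = G"
    by (auto simp: del_vert_def intro!: pre_digraph.equality)
  then show ?thesis
    using assms(1) by simp
qed

text \<open>In either case at most one component is left after the deletion: none if
  \<open>v\<close> was the only vertex, otherwise one by connectedness.\<close>

lemma (in wf_digraph) not_cut_vertex:
  assumes "connected G" "v \<in> verts G \<Longrightarrow> verts G \<noteq> {v} \<Longrightarrow> connected (del_vert v)"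
  shows "\<not> cut_vertex G v"
proof
  assume cut: "cut_vertex G v"
  then have v: "v \<in> verts G"
    by (simp add: cut_vertex_def)
  interpret D: wf_digraph "del_vert v"
    by (rule wf_digraph_del_vert)
  have "card (components (del_vert v)) \<le> 1"
  proof (cases "verts G = {v}")
    case True
    then show ?thesis
      by (simp add: components_empty del_vert_simps)
  next
    case False
    then show ?thesis
      using assms(2) v by (simp add: D.components_connected)
  qed
  then show False
    using cut assms(1) by (simp add: cut_vertex_def components_connected)
qed

text \<open>The union of the two blocks is again connected without cut-vertex, so by maximality it
  equals each of them.\<close>

lemma (in fin_digraph) blocks_eq_if_two_common_verts:
  assumes B: "B \<in> blocks G" "C \<in> blocks G"
    and xy: "x \<noteq> y" "x \<in> verts B" "x \<in> verts C" "y \<in> verts B" "y \<in> verts C"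
  shows "B = C"
proof -
  let ?P = "\<lambda>H. connected H \<and> (\<nexists>v. cut_vertex H v)"
  let ?U = "union B C"
  have max: "max_subgraph ?P B" "max_subgraph ?P C"
    using B by (auto simp: blocks_def)
  then have sub: "subgraph B G" "subgraph C G" and P: "?P B" "?P C"
    by (auto simp: max_subgraph_def)
  have compat: "compatible B C" and wf: "wf_digraph B" "wf_digraph C"
    using sub unfolding subgraph_def compatible_def by auto
  interpret B: fin_digraph B
    using sub(1) by (rule fin_digraph_subgraph)
  interpret C: fin_digraph C
    using sub(2) by (rule fin_digraph_subgraph)
  have subU: "subgraph B ?U" "subgraph C ?U"
    using subgraphs_of_union[OF wf compat] by auto
  have UG: "subgraph ?U G"
    using sub compat wf by (simp add: subgraph_union_iff)
  interpret U: wf_digraph ?U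
    using wf compat by (rule wellformed_union)
  have "connected ?U"
    using sub P xy by (intro connected_union) auto
  moreover have "\<not> cut_vertex ?U v" for v
  proof (rule U.not_cut_vertex)
    have del: "U.del_vert v = union (B.del_vert v) (C.del_vert v)"
      using compat
      by (auto simp: pre_digraph.del_vert_def union_def compatible_def)
    \<comment> \<open>At least one of \<open>x\<close> and \<open>y\<close> differs from
      \<open>v\<close>; the two connected remainders are joined there.\<close>
    obtain z where z: "z \<in> verts (B.del_vert v)" "z \<in> verts (C.del_vert v)"
      using xy by (metis B.verts_del_vert C.verts_del_vert Diff_iff singletonD)
    have "subgraph (B.del_vert v) G" "subgraph (C.del_vert v) G"
      using sub B.subgraph_del_vert C.subgraph_del_vert by (auto intro: subgraph_trans)
    moreover have "connected (B.del_vert v)" "connected (C.del_vert v)"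
      using P xy by (auto intro!: B.connected_del_vert C.connected_del_vert)
    ultimately show "connected (U.del_vert v)"
      unfolding del using z by (intro connected_union)
  qed fact
  ultimately have "?P ?U"
    by auto
  then have "?U = B" "?U = C"
    using max subU UG unfolding max_subgraph_def by blast+
  then show ?thesis
    by simp
qed

lemma (in fin_digraph) vert_in_block:
  assumes "x \<in> verts G"
  obtains B where "B \<in> blocks G" "x \<in> verts B"
proof -
  let ?P = "\<lambda>H. connected H \<and> (\<nexists>v. cut_vertex H v)"
  let ?H = "singleton_subgraph G x"
  have sub: "subgraph ?H G"
    using assms by (rule subgraph_singleton)
  interpret H: wf_digraph ?H
    using sub by auto
  have verts: "verts ?H = {x}"
    by (simp add: singleton_subgraph_def)
  then have "connected ?H"
    by (rule connected_of_verts_singleton)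
  moreover from this have "\<not> cut_vertex ?H v" for v
    by (rule H.not_cut_vertex) (use verts in auto)
  ultimately obtain B where "max_subgraph ?P B" "subgraph ?H B"
    using ex_max_subgraph[OF sub, of ?P] by blast
  then show ?thesis
    using that verts by (auto simp: blocks_def)
qed

text \<open>An arc with its ends is connected, and deleting one of two distinct ends leaves a single
  vertex, so there is no cut-vertex and the arc extends to a block.\<close>

lemma (in fin_digraph) arc_in_block:
  assumes "e \<in> arcs G"
  obtains B where "B \<in> blocks G" "e \<in> arcs B"
proof -
  let ?P = "\<lambda>H. connected H \<and> (\<nexists>v. cut_vertex H v)"
  let ?H = "\<lparr> verts = {tail G e, head G e}, arcs = {e}, tail = tail G, head = head G \<rparr>"
  have sub: "subgraph ?H G"
    using assms wf_digraph by (auto simp: subgraph_def compatible_def wf_digraph_def)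
  interpret H: wf_digraph ?H
    using sub by auto
  interpret S: pair_wf_digraph "mk_symmetric ?H"
    by (rule H.wellformed_mk_symmetric)
  have "tail G e \<rightarrow>\<^sup>*\<^bsub>mk_symmetric ?H\<^esub> head G e" "head G e \<rightarrow>\<^sup>*\<^bsub>mk_symmetric ?H\<^esub> tail G e"
    by (auto simp: parcs_mk_symmetric intro!: S.reachable_adjI)
  then have "connected ?H"
    by (auto simp: connected_iff)
  moreover from this have "\<not> cut_vertex ?H v" for v
  proof (rule H.not_cut_vertex)
    assume "v \<in> verts ?H" "verts ?H \<noteq> {v}"
    then have "verts (H.del_vert v) = {if v = tail G e then head G e else tail G e}"
      by (auto simp: H.del_vert_simps)
    then show "connected (H.del_vert v)"
      by (rule connected_of_verts_singleton)
  qed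
  ultimately obtain B where "max_subgraph ?P B" "subgraph ?H B"
    using ex_max_subgraph[OF sub, of ?P] by blast
  then show ?thesis
    using that by (auto simp: blocks_def)
qed

lemma (in wf_digraph) blocks_if_no_cut_vertex:
  assumes "connected G" "\<nexists>v. cut_vertex G v"
  shows "blocks G = {G}"
  unfolding blocks_def
  using max_subgraph_iff_eq[of "\<lambda>H. connected H \<and> (\<nexists>v. cut_vertex H v)"] assms by auto

lemma (in wf_digraph) strongly_connected_imp_connected:
  assumes "strongly_connected G"
  shows "connected G"
  using assms by (auto simp: connected_iff strongly_connected_def intro: reachable_mk_symmetricI)


section \<open>Adjacency entries and isomorphisms\<close>

text \<open>Only the arcs from \<open>p\<close> to \<open>q\<close> matter, so the entry survives
  both the deletion of other vertices and the passage from \<open>G\<close> to a block.\<close>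

lemma adj_entry_cong:
  assumes "\<And>e. e \<in> arcs G \<and> arc_to_ends G e = (p, q) \<longleftrightarrow> e \<in> arcs H \<and> arc_to_ends H e = (p, q)"
  shows "adj_entry G w p q = adj_entry H w p q"
proof -
  have "p \<rightarrow>\<^bsub>G\<^esub> q \<longleftrightarrow> p \<rightarrow>\<^bsub>H\<^esub> q"
    using assms unfolding arcs_ends_def by (metis (no_types, lifting) image_iff)
  then show ?thesis
    unfolding adj_entry_def using assms by simp
qed

lemma adj_entry_del_vert:
  assumes "p \<noteq> v" "q \<noteq> v"
  shows "adj_entry (pre_digraph.del_vert G v) w p q = adj_entry G w p q"
  using assms by (intro adj_entry_cong) (auto simp: pre_digraph.del_vert_def arc_to_ends_def)

lemma digraph_det_del_vert:
  assumes "finite (verts G)"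
  shows "digraph_det (pre_digraph.del_vert G v) w = det_on (adj_entry G w) (verts G - {v})"
proof -
  have "digraph_det (pre_digraph.del_vert G v) w
      = det_on (adj_entry (pre_digraph.del_vert G v) w) (verts G - {v})"
    using assms by (subst digraph_det_eq_det_on) (simp_all add: pre_digraph.del_vert_def)
  also have "\<dots> = det_on (adj_entry G w) (verts G - {v})"
    using assms by (intro det_on_cong) (auto simp: adj_entry_del_vert)
  finally show ?thesis .
qed

lemma (in nomulti_digraph) adj_entry_arc:
  assumes "e \<in> arcs G" "tail G e = p" "head G e = q"
  shows "adj_entry G w p q = w e"
proof -
  have "(THE e. e \<in> arcs G \<and> arc_to_ends G e = (p, q)) = e"
    using assms no_multi_arcs by (intro the_equality) (auto simp: arc_to_ends_def)
  moreover have "p \<rightarrow> q"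
    using assms by (auto simp: arcs_ends_conv)
  ultimately show ?thesis
    by (simp add: adj_entry_def)
qed

lemma adj_entry_eq_0:
  assumes "\<And>e. e \<in> arcs G \<Longrightarrow> tail G e = p \<Longrightarrow> head G e \<noteq> q"
  shows "adj_entry G w p q = 0"
  using assms by (auto simp: adj_entry_def arcs_ends_conv)

lemma (in nomulti_digraph) adj_entry_app_iso:
  assumes iso: "digraph_isomorphism f"
    and w: "\<And>e. e \<in> arcs G \<Longrightarrow> w' (iso_arcs f e) = w e"
    and pq: "p \<in> verts G" "q \<in> verts G"
  shows "adj_entry (app_iso f G) w' (iso_verts f p) (iso_verts f q) = adj_entry G w p q"
proof -
  let ?H = "app_iso f G"
  have wfH: "wf_digraph ?H"
    using iso by (rule wf_digraphI_app_iso)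
  have eq: "iso_verts f x = iso_verts f y \<longleftrightarrow> x = y" if "x \<in> verts G" "y \<in> verts G" for x y
    using iso that by (rule iso_verts_eq_iff)
  have ends: "iso_tail f (iso_arcs f e) = iso_verts f (tail G e)"
      "iso_head f (iso_arcs f e) = iso_verts f (head G e)" if "e \<in> arcs G" for e
    using iso that by (simp_all add: iso_verts_tail iso_verts_head)
  \<comment> \<open>Absence of parallel arcs in the image is what resolves the \<open>THE\<close> in
    its adjacency entries.\<close>
  interpret H: nomulti_digraph ?H
  proof (rule nomulti_digraph.intro[OF wfH], unfold_locales)
    fix e1 e2
    assume "e1 \<in> arcs ?H" "e2 \<in> arcs ?H" and same: "arc_to_ends ?H e1 = arc_to_ends ?H e2"
    then obtain d1 d2 where d: "d1 \<in> arcs G" "d2 \<in> arcs G"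
      and e: "e1 = iso_arcs f d1" "e2 = iso_arcs f d2"
      by auto
    have "arc_to_ends G d1 = arc_to_ends G d2"
      using same d unfolding e by (simp add: arc_to_ends_def ends eq)
    then show "e1 = e2"
      using no_multi_arcs d e by blast
  qed
  show ?thesis
  proof (cases "\<exists>e \<in> arcs G. tail G e = p \<and> head G e = q")
    case True
    then obtain e where e: "e \<in> arcs G" "tail G e = p" "head G e = q"
      by blast
    then have "adj_entry ?H w' (iso_verts f p) (iso_verts f q) = w' (iso_arcs f e)"
      by (intro H.adj_entry_arc) (auto simp: ends)
    then show ?thesis
      using e by (simp add: w adj_entry_arc)
  next
    case False
    have "adj_entry ?H w' (iso_verts f p) (iso_verts f q) = 0"
    proof (rule adj_entry_eq_0)
      fix d assume "d \<in> arcs ?H" "tail ?H d = iso_verts f p"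
      then obtain e where e: "e \<in> arcs G" "d = iso_arcs f e" "tail G e = p"
        using pq by (auto simp: ends eq)
      then show "head ?H d \<noteq> iso_verts f q"
        using False pq by (auto simp: ends eq)
    qed
    moreover have "adj_entry G w p q = 0"
      using False by (intro adj_entry_eq_0) auto
    ultimately show ?thesis
      by simp
  qed
qed

section \<open>Rotation symmetry of negative mixed complete graphs\<close>

lemma verts_neg_mixed_complete [simp]: "verts (neg_mixed_complete n) = {1..n}"
  by (simp add: neg_mixed_complete_def)

lemma adj_entry_neg_mixed_complete:
  "adj_entry (neg_mixed_complete n) (neg_mixed_weight n) p q =
    (if (p, q) \<in> cycle_arcs n then -1 else if (p, q) \<in> chord_arcs n then 1 else 0)"
proof -
  have "(THE e. e \<in> arcs (neg_mixed_complete n) \<and> arc_to_ends (neg_mixed_complete n) e = (p, q))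
      = (p, q)" if "(p, q) \<in> cycle_arcs n \<union> chord_arcs n"
    using that by (intro the_equality) (auto simp: neg_mixed_complete_def arc_to_ends_def)
  then show ?thesis
    by (auto simp: adj_entry_def neg_mixed_complete_def neg_mixed_weight_def arcs_ends_conv)
qed

section \<open>The rotation of the cycle\<close>

lemma cycle_next_in: "i \<in> {1..n} \<Longrightarrow> cycle_next n i \<in> {1..n}"
  by (auto simp: cycle_next_def)

lemma inj_on_cycle_next: "inj_on (cycle_next n) {1..n}"
  by (auto simp: inj_on_def cycle_next_def split: if_splits)

lemma cycle_next_image: "cycle_next n ` {1..n} = {1..n}"
  by (rule endo_inj_surj[OF _ _ inj_on_cycle_next]) (auto simp: cycle_next_def)

text \<open>The rotation permutes the vertices and preserves cycle arcs in both directions; chords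
  are defined through cycle arcs, hence are preserved too.\<close>

lemma adj_entry_rotate:
  assumes "p \<in> {1..n}" "q \<in> {1..n}"
  shows "adj_entry (neg_mixed_complete n) (neg_mixed_weight n) (cycle_next n p) (cycle_next n q)
    = adj_entry (neg_mixed_complete n) (neg_mixed_weight n) p q"
proof -
  have eq: "cycle_next n x = cycle_next n y \<longleftrightarrow> x = y" if "x \<in> {1..n}" "y \<in> {1..n}" for x y
    using inj_on_eq_iff[OF inj_on_cycle_next] that by blast
  have mem: "(x, y) \<in> cycle_arcs n \<longleftrightarrow> x \<in> {1..n} \<and> y = cycle_next n x" for x y
    by (auto simp: cycle_arcs_def)
  have cycle: "(cycle_next n x, cycle_next n y) \<in> cycle_arcs n \<longleftrightarrow> (x, y) \<in> cycle_arcs n"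
    if "x \<in> {1..n}" "y \<in> {1..n}" for x y
    using that cycle_next_in[of x n] eq[of y "cycle_next n x"] unfolding mem by auto
  have "(cycle_next n p, cycle_next n q) \<in> chord_arcs n \<longleftrightarrow> (p, q) \<in> chord_arcs n"
    using assms cycle[of p q] cycle[of q p] eq[of p q] cycle_next_in[of p n] cycle_next_in[of q n]
    unfolding chord_arcs_def by auto
  then show ?thesis
    using cycle assms by (simp add: adj_entry_neg_mixed_complete)
qed

lemma digraph_det_del_vert_neg_mixed_complete:
  assumes "u \<in> {1..n}" "v \<in> {1..n}"
  shows "digraph_det (pre_digraph.del_vert (neg_mixed_complete n) u) (neg_mixed_weight n)
    = digraph_det (pre_digraph.del_vert (neg_mixed_complete n) v) (neg_mixed_weight n)"
proof -
  let ?f = "adj_entry (neg_mixed_complete n) (neg_mixed_weight n)"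
  have step: "det_on ?f ({1..n} - {cycle_next n u}) = det_on ?f ({1..n} - {u})"
    if u: "u \<in> {1..n}" for u
  proof -
    have inj: "inj_on (cycle_next n) ({1..n} - {u})"
      by (rule inj_on_subset[OF inj_on_cycle_next]) auto
    have "{1..n} - {cycle_next n u} = cycle_next n ` ({1..n} - {u})"
      using inj_on_image_set_diff[OF inj_on_cycle_next, of "{1..n}" "{u}" n] u
      unfolding cycle_next_image by simp
    then have "det_on ?f ({1..n} - {cycle_next n u})
        = det_on (\<lambda>x y. ?f (cycle_next n x) (cycle_next n y)) ({1..n} - {u})"
      using inj by (simp add: det_on_image)
    also have "\<dots> = det_on ?f ({1..n} - {u})"
      by (rule det_on_cong) (auto simp: adj_entry_rotate)
    finally show ?thesis .
  qed
  \<comment> \<open>Each rotation moves the deleted vertex one step along the cycle. The index is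
    shifted so that the induction starts at vertex 1 and never has to wrap around.\<close>
  have Suc_eq: "det_on ?f ({1..n} - {Suc i}) = det_on ?f ({1..n} - {1})" if "Suc i \<le> n" for i
    using that
  proof (induction i)
    case (Suc i)
    then show ?case
      using step[of "Suc i"] by (simp add: cycle_next_def)
  qed simp
  have "det_on ?f ({1..n} - {u}) = det_on ?f ({1..n} - {1})" if "u \<in> {1..n}" for u
    using Suc_eq[of "u - 1"] that by simp
  from this[OF assms(1)] this[OF assms(2)] show ?thesis
    by (simp add: digraph_det_del_vert)
qed

text \<open>The isomorphism forces \<open>m\<close> to be the number of vertices. It sends
  \<open>c\<close> to an uncontrolled vertex, which rotation symmetry then exchanges for the
  prescribed \<open>v\<close>.\<close>

lemma weighted_iso_neg_mixed_complete:
  assumes "digraph H" and iso: "weighted_iso H w (neg_mixed_complete m) (neg_mixed_weight m)"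
    and n: "n = card (verts H)"
  shows "digraph_det (neg_mixed_complete n) (neg_mixed_weight n)
      = det_on (adj_entry H w) (verts H)"
    and "c \<in> verts H \<Longrightarrow> v \<in> {1..n} \<Longrightarrow>
      digraph_det (pre_digraph.del_vert (neg_mixed_complete n) v) (neg_mixed_weight n)
      = det_on (adj_entry H w) (verts H - {c})"
proof -
  interpret H: digraph H by fact
  let ?K = "neg_mixed_complete m" and ?w = "neg_mixed_weight m"
  obtain f where f: "H.digraph_isomorphism f" and K: "?K = app_iso f H"
    and w: "\<And>e. e \<in> arcs H \<Longrightarrow> ?w (iso_arcs f e) = w e"
    using iso by (auto simp: weighted_iso_def)
  let ?h = "iso_verts f"
  have inj: "inj_on ?h (verts H)"
    using f by (rule H.digraph_isomorphism_inj_on_verts)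
  have img: "?h ` verts H = {1..m}"
    using arg_cong[OF K, of verts] by simp
  have m: "n = m"
    using card_image[OF inj] by (simp add: img n)
  have det: "det_on (adj_entry ?K ?w) (?h ` S) = det_on (adj_entry H w) S"
    if S: "S \<subseteq> verts H" for S
  proof -
    have fin: "finite S"
      using S H.finite_verts by (rule finite_subset)
    have "det_on (adj_entry ?K ?w) (?h ` S) = det_on (\<lambda>x y. adj_entry ?K ?w (?h x) (?h y)) S"
      using fin inj S by (intro det_on_image) (auto intro: inj_on_subset)
    also have "\<dots> = det_on (adj_entry H w) S"
      unfolding K using fin f w S by (intro det_on_cong H.adj_entry_app_iso) auto
    finally show ?thesis .
  qed
  show "digraph_det (neg_mixed_complete n) (neg_mixed_weight n)
      = det_on (adj_entry H w) (verts H)"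
    using det[of "verts H"] by (simp add: digraph_det_eq_det_on img m)
  assume c: "c \<in> verts H" and v: "v \<in> {1..n}"
  have hc: "?h c \<in> {1..m}"
    using c img by blast
  have "?h ` (verts H - {c}) = {1..m} - {?h c}"
    using inj_on_image_set_diff[OF inj, of "verts H" "{c}"] c by (simp add: img)
  then have "det_on (adj_entry H w) (verts H - {c})
      = digraph_det (pre_digraph.del_vert ?K (?h c)) ?w"
    using det[of "verts H - {c}"] by (simp add: digraph_det_del_vert)
  also have "\<dots> = digraph_det (pre_digraph.del_vert ?K v) ?w"
    using hc v m by (intro digraph_det_del_vert_neg_mixed_complete) auto
  finally show "digraph_det (pre_digraph.del_vert (neg_mixed_complete n) v) (neg_mixed_weight n)
      = det_on (adj_entry H w) (verts H - {c})"
    by (simp add: m)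
qed

section \<open>The determinant of a negative mixed star block graph\<close>

theorem theorem13:
  fixes G :: "('a, 'b) pre_digraph" and w :: "'b weight_fun"
    and k :: nat and B :: "nat \<Rightarrow> ('a, 'b) pre_digraph"
    and n :: "nat \<Rightarrow> nat" and v :: "nat \<Rightarrow> nat"
  assumes star: "neg_mixed_star_block_graph G w"
    and blocks: "bij_betw B {1..k} (blocks G)"
    and orders: "\<And>i. i \<in> {1..k} \<Longrightarrow> n i = card (verts (B i))"
    and deleted: "\<And>j. j \<in> {1..k} \<Longrightarrow> v j \<in> verts (neg_mixed_complete (n j))"
  defines "D \<equiv> \<lambda>j. digraph_det (pre_digraph.del_vert (neg_mixed_complete (n j)) (v j))
                      (neg_mixed_weight (n j))"
  shows "digraph_det G w =
    (\<Sum>i = 1..k. digraph_det (neg_mixed_complete (n i)) (neg_mixed_weight (n i)) *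
       (\<Prod>j \<in> {1..k} - {i}. D j))"
proof -
  have "digraph G" and strong: "strongly_connected G"
    and iso: "\<And>H. H \<in> blocks G \<Longrightarrow>
      \<exists>m > 3. weighted_iso H w (neg_mixed_complete m) (neg_mixed_weight m)"
    and cut: "\<And>c H. cut_vertex G c \<Longrightarrow> H \<in> blocks G \<Longrightarrow> c \<in> verts H"
    using star by (auto simp: neg_mixed_star_block_graph_def)
  interpret digraph G by fact
  have conn: "connected G"
    using strong by (rule strongly_connected_imp_connected)
  let ?a = "adj_entry G w" and ?I = "{1..k}"
  have img: "B ` ?I = blocks G"
    using blocks by (simp add: bij_betw_def)
  have block: "B i \<in> blocks G" if "i \<in> ?I" for i
    using img that by blast
  have sub: "subgraph (B i) G" if "i \<in> ?I" for i
    using block[OF that] by (simp add: blocks_def max_subgraph_def)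
  have compat: "tail (B i) = tail G" "head (B i) = head G" if "i \<in> ?I" for i
    using sub[OF that] by (simp_all add: subgraph_def compatible_def)

  \<comment> \<open>If there is no cut-vertex, \<open>G\<close> is its own only block and any vertex
    can serve as the centre.\<close>
  obtain c where "c \<in> verts G" and c: "\<And>i. i \<in> ?I \<Longrightarrow> c \<in> verts (B i)"
  proof (cases "\<exists>c. cut_vertex G c")
    case True
    then obtain c where "cut_vertex G c" ..
    then show ?thesis
      using that[of c] cut block by (auto simp: cut_vertex_def)
  next
    case False
    then have "blocks G = {G}"
      using conn by (simp add: blocks_if_no_cut_vertex)
    moreover obtain c where "c \<in> verts G"
      using strong by (auto simp: strongly_connected_def)
    ultimately show ?thesis
      using that[of c] block by auto
  qed

  have unique: "i = j"
    if "i \<in> ?I" "j \<in> ?I" "x \<noteq> y" "x \<in> verts (B i)" "x \<in> verts (B j)"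
      "y \<in> verts (B i)" "y \<in> verts (B j)" for i j x y
  proof -
    have "B i = B j"
      by (rule blocks_eq_if_two_common_verts[of _ _ x y]) (use that block in auto)
    then show ?thesis
      using blocks that by (auto simp: bij_betw_def inj_on_eq_iff)
  qed
  have arc_block: "\<exists>i \<in> ?I. e \<in> arcs (B i) \<and> tail G e \<in> verts (B i) \<and> head G e \<in> verts (B i)"
    if "e \<in> arcs G" for e
  proof -
    obtain H where "H \<in> blocks G" "e \<in> arcs H"
      using \<open>e \<in> arcs G\<close> by (rule arc_in_block)
    then obtain i where i: "i \<in> ?I" "e \<in> arcs (B i)"
      using img by (metis imageE)
    moreover have "wf_digraph (B i)"
      using sub[OF i(1)] by auto
    ultimately show ?thesis
      using compat by (metis wf_digraph.tail_in_verts wf_digraph.head_in_verts)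
  qed

  define V where "V i = verts (B i) - {c}" for i
  have verts: "verts G = insert c (\<Union>i\<in>?I. V i)"
  proof
    show "insert c (\<Union>i\<in>?I. V i) \<subseteq> verts G"
      using \<open>c \<in> verts G\<close> subgraph_imp_subverts[OF sub] by (fastforce simp: V_def)
    show "verts G \<subseteq> insert c (\<Union>i\<in>?I. V i)"
    proof
      fix x assume "x \<in> verts G"
      then obtain H where "H \<in> blocks G" "x \<in> verts H"
        by (rule vert_in_block)
      then show "x \<in> insert c (\<Union>i\<in>?I. V i)"
        unfolding V_def img[symmetric] by auto
    qed
  qed
  \<comment> \<open>A common element would be a second common vertex besides
    \<open>c\<close>.\<close>
  have disj: "V i \<inter> V j = {}" if "i \<in> ?I" "j \<in> ?I" "i \<noteq> j" for i j
    unfolding V_def using unique[of i j c] c[OF that(1)] c[OF that(2)] that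
    by (intro equals0I) (metis DiffE IntE insertI1)
  have loop: "?a x x = 0" for x
    by (rule adj_entry_eq_0) (auto dest: no_loops)
  \<comment> \<open>Such an arc would lie in a block \<open>B l\<close>, and \<open>V l\<close>
    would meet both \<open>V i\<close> and \<open>V j\<close>.\<close>
  have zero: "?a x y = 0"
    if ij: "i \<in> ?I" "j \<in> ?I" "i \<noteq> j" and x: "x \<in> V i" and y: "y \<in> V j" for i j x y
  proof (rule adj_entry_eq_0, rule notI)
    fix e assume e: "e \<in> arcs G" "tail G e = x" "head G e = y"
    then obtain l where l: "l \<in> ?I" "x \<in> verts (B l)" "y \<in> verts (B l)"
      using arc_block by blast
    then have "x \<in> V l" "y \<in> V l"
      using x y by (auto simp: V_def)
    then have "l = i" "l = j"
      using disj[OF l(1) ij(1)] disj[OF l(1) ij(2)] x y by auto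
    then show False
      using ij(3) by simp
  qed
  \<comment> \<open>Blocks are induced subdigraphs: the block containing an arc between
    \<open>x\<close> and \<open>y\<close> shares two vertices with \<open>B i\<close>, distinct
    since there are no loops.\<close>
  have inside: "adj_entry (B i) w x y = ?a x y"
    if i: "i \<in> ?I" and xy: "x \<in> verts (B i)" "y \<in> verts (B i)" for i x y
  proof (rule adj_entry_cong)
    fix e
    have "e \<in> arcs (B i)" if e: "e \<in> arcs G" "tail G e = x" "head G e = y"
    proof -
      obtain j where j: "j \<in> ?I" "e \<in> arcs (B j)" "x \<in> verts (B j)" "y \<in> verts (B j)"
        using arc_block e by blast
      moreover have "x \<noteq> y"
        using e no_loops by auto
      ultimately have "j = i"
        using unique[of j i x y] i xy by simp
      then show ?thesis
        using j by simp
    qed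
    moreover have "arcs (B i) \<subseteq> arcs G"
      using sub[OF i] by auto
    ultimately show "e \<in> arcs (B i) \<and> arc_to_ends (B i) e = (x, y)
        \<longleftrightarrow> e \<in> arcs G \<and> arc_to_ends G e = (x, y)"
      using compat[OF i] by (auto simp: arc_to_ends_def)
  qed
  have fin: "finite (verts (B i))" if "i \<in> ?I" for i
    using subgraph_imp_subverts[OF sub[OF that]] finite_verts by (rule finite_subset)
  then have finV: "finite (V i)" if "i \<in> ?I" for i
    using that by (simp add: V_def)
  have notin: "c \<notin> V i" for i
    by (simp add: V_def)

  have whole: "digraph_det (neg_mixed_complete (n i)) (neg_mixed_weight (n i))
      = det_on ?a (insert c (V i))"
    and part: "D i = det_on ?a (V i)" if i: "i \<in> ?I" for i
  proof -
    obtain m where m: "weighted_iso (B i) w (neg_mixed_complete m) (neg_mixed_weight m)"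
      using iso block[OF i] by blast
    note dets = weighted_iso_neg_mixed_complete[OF digraph_subgraph[OF sub[OF i]] m orders[OF i]]
    have "det_on (adj_entry (B i) w) (verts (B i)) = det_on ?a (verts (B i))"
      using fin[OF i] inside[OF i] by (rule det_on_cong)
    moreover have "verts (B i) = insert c (V i)"
      using c[OF i] by (auto simp: V_def)
    ultimately show "digraph_det (neg_mixed_complete (n i)) (neg_mixed_weight (n i))
        = det_on ?a (insert c (V i))"
      using dets(1) by simp
    have "det_on (adj_entry (B i) w) (verts (B i) - {c}) = det_on ?a (verts (B i) - {c})"
      using fin[OF i] inside[OF i] by (intro det_on_cong) auto
    then show "D i = det_on ?a (V i)"
      using dets(2)[OF c[OF i]] deleted[OF i] unfolding D_def V_def by simp
  qed

  \<comment> \<open>Assembling the block determinants\<close>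
  have "digraph_det G w = det_on ?a (insert c (\<Union>i\<in>?I. V i))"
    unfolding verts[symmetric] by (rule digraph_det_eq_det_on) simp
  also have "\<dots> = (\<Sum>i\<in>?I. det_on ?a (insert c (V i)) * (\<Prod>j\<in>?I - {i}. det_on ?a (V j)))"
    by (rule det_on_star[OF finite_atLeastAtMost finV notin disj zero loop])
  also have "\<dots> = (\<Sum>i = 1..k. digraph_det (neg_mixed_complete (n i)) (neg_mixed_weight (n i)) *
       (\<Prod>j \<in> {1..k} - {i}. D j))"
    by (intro sum.cong refl arg_cong2[of _ _ _ _ "(*)"] prod.cong) (simp_all add: whole part)
  finally show ?thesis .
qed

end
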